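(* Let $n,m\ge 2$ and $G=P_n\square P_m$. Suppose $(\mathbf d,\mathbf r)$ is an arithmetical structure on $G$ such that $r_{i,j}=r_j$ for all $i=1,\dots,n$ and $j=1,\dots,m$. Then the vector $(r_1,r_2,\dots,r_m)$ satisfies $r_j\mid (r_{j-1}+r_{j+1})$ for all $j$ and hence determines an arithmetical structure on $P_m$. Conversely, any arithmetical structure on $P_m$, with $\mathbf r$-vector $(r_1,\dots,r_m)$, induces such a column-constant arithmetical structure on $G$ (with $r_{i,j}=r_j$), where $$d_{i,j}=\frac{r_{j-1}+r_{j+1}}{r_j}+c_i,$$ with $c_i=2$ for $1<i<n$ and $c_i=1$ for $i=1,n$.
   Context: An arithmetical structure on a finite connected graph $G$ is a pair $(\mathbf d,\mathbf r)$ of vectors of positive integers indexed by the vertices of $G$ such that $\mathbf r$ is primitive (the gcd of its entries is $1$) and $(\operatorname{diag}(\mathbf d)-A(G))\mathbf r=0$, where $A(G)$ is the adjacency matrix of $G$; $\mathbf d$ and $\mathbf r$ determine each other. $P_n$ is the path graph with vertex set $\{1,\dots,n\}$ and edges $\{i,i+1\}$, $1\le i<n$. The grid graph $P_n\square P_m$ has vertices $(i,j)$, $1\le i\le n$, $1\le j\le m$, with $(i,j)$ and $(k,\ell)$ adjacent iff ($i=k$ and $|j-\ell|=1$) or ($j=\ell$ and $|i-k|=1$). Convention: $r_0=r_{m+1}=0$. *)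

theory Defs
  imports "Graph_Theory.Graph_Theory"
begin

text \<open>
  A finite simple graph is a \<open>pair_graph\<close>: a finite, symmetric, loop-free set of arcs without
  parallel arcs. The edge \<open>{u, v}\<close> is represented by the two arcs \<open>(u, v)\<close> and \<open>(v, u)\<close>.
  Vectors and matrices indexed by the vertices are total functions of which only the values
  on \<open>pverts G\<close> matter.
\<close>

definition adjacency :: "'a pair_pre_digraph \<Rightarrow> 'a \<Rightarrow> 'a \<Rightarrow> int" where
  "adjacency G u v = (if (u, v) \<in> parcs G then 1 else 0)"

definition diag :: "('a \<Rightarrow> int) \<Rightarrow> 'a \<Rightarrow> 'a \<Rightarrow> int" where
  "diag d u v = (if u = v then d u else 0)"

definition mult_vec :: "'a set \<Rightarrow> ('a \<Rightarrow> 'a \<Rightarrow> int) \<Rightarrow> ('a \<Rightarrow> int) \<Rightarrow> 'a \<Rightarrow> int" where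
  "mult_vec V M x u = (\<Sum>v\<in>V. M u v * x v)"

text \<open>The name \<open>connected\<close> alone may also refer to topological connectedness.\<close>

definition arithmetical_structure ::
    "'a pair_pre_digraph \<Rightarrow> ('a \<Rightarrow> int) \<Rightarrow> ('a \<Rightarrow> int) \<Rightarrow> bool" where
  "arithmetical_structure G d r \<longleftrightarrow>
     pair_graph G \<and> Digraph_Component.connected (with_proj G) \<and>
     (\<forall>v\<in>pverts G. d v > 0 \<and> r v > 0) \<and>
     Gcd (r ` pverts G) = 1 \<and>
     (\<forall>u\<in>pverts G. mult_vec (pverts G) (\<lambda>u v. diag d u v - adjacency G u v) r u = 0)"

definition path_graph :: "nat \<Rightarrow> nat pair_pre_digraph" where
  "path_graph n =
     \<lparr> pverts = {1..n},
       parcs = {(i, j). i \<in> {1..n} \<and> j \<in> {1..n} \<and> (j = i + 1 \<or> i = j + 1)} \<rparr>"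

definition grid_graph :: "nat \<Rightarrow> nat \<Rightarrow> (nat \<times> nat) pair_pre_digraph" where
  "grid_graph n m =
     \<lparr> pverts = {1..n} \<times> {1..m},
       parcs = {((i, j), (k, l)).
          (i, j) \<in> {1..n} \<times> {1..m} \<and> (k, l) \<in> {1..n} \<times> {1..m} \<and>
          (i = k \<and> \<bar>int j - int l\<bar> = 1 \<or> j = l \<and> \<bar>int i - int k\<bar> = 1)} \<rparr>"

text \<open>
  The convention \<open>x\<^sub>0 = x\<^sub>m\<^sub>+\<^sub>1 = 0\<close> for a vector \<open>x\<close> on the vertices of the path on \<open>{1..m}\<close>.
\<close>

definition zero_ext :: "nat \<Rightarrow> (nat \<Rightarrow> int) \<Rightarrow> nat \<Rightarrow> int" where
  "zero_ext m x j = (if j \<in> {1..m} then x j else 0)"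

definition end_const :: "nat \<Rightarrow> nat \<Rightarrow> int" where
  "end_const n i = (if 1 < i \<and> i < n then 2 else 1)"

text \<open>
  The graph conditions in \<open>arithmetical_structure\<close> hold for paths and grids, so they do not
  restrict the structures on these graphs.
\<close>

lemma pair_graph_path_graph: "pair_graph (path_graph n)"
proof -
  have "finite (parcs (path_graph n))"
    by (rule finite_subset[of _ "{1..n} \<times> {1..n}"]) (auto simp: path_graph_def)
  then show ?thesis
    by unfold_locales (auto simp: path_graph_def symmetric_def sym_def)
qed

lemma pair_graph_grid_graph: "pair_graph (grid_graph n m)"
proof -
  have "finite (parcs (grid_graph n m))"
    by (rule finite_subset[of _ "({1..n} \<times> {1..m}) \<times> ({1..n} \<times> {1..m})"])
       (auto simp: grid_graph_def)
  then show ?thesis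
    by unfold_locales (auto simp: grid_graph_def symmetric_def sym_def)
qed

lemma connected_if_reachable_from:
  assumes "pair_graph G" and "v0 \<in> pverts G"
    and reach: "\<And>v. v \<in> pverts G \<Longrightarrow> v0 \<rightarrow>\<^sup>*\<^bsub>with_proj G\<^esub> v"
  shows "Digraph_Component.connected (with_proj G)"
proof -
  interpret pair_graph G by fact
  have sym: "symmetric (with_proj G)" by (rule pair_sym_arcs)
  have "u \<rightarrow>\<^sup>*\<^bsub>with_proj G\<^esub> v" if "u \<in> pverts G" "v \<in> pverts G" for u v
    using symmetric_reachable[OF sym reach[OF that(1)]] reach[OF that(2)]
    by (rule reachable_trans)
  then have "u \<rightarrow>\<^sup>*\<^bsub>with_proj (mk_symmetric (with_proj G))\<^esub> v"
    if "u \<in> pverts G" "v \<in> pverts G" for u v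
    using that by (intro reachable_mk_symmetricI) auto
  then show ?thesis
    using assms(2) by (auto simp: connected_def strongly_connected_def)
qed

lemma connected_path_graph:
  assumes "n \<ge> 1"
  shows "Digraph_Component.connected (with_proj (path_graph n))"
proof (rule connected_if_reachable_from[OF pair_graph_path_graph])
  interpret pair_graph "path_graph n" by (rule pair_graph_path_graph)
  show "1 \<in> pverts (path_graph n)" using assms by (simp add: path_graph_def)
  have "1 \<le> v \<Longrightarrow> v \<le> n \<Longrightarrow> 1 \<rightarrow>\<^sup>*\<^bsub>with_proj (path_graph n)\<^esub> v" for v
  proof (induction v rule: dec_induct)
    case base
    show ?case using assms by (intro reachable_refl) (simp add: path_graph_def)
  next
    case (step v)
    then have "1 \<rightarrow>\<^sup>*\<^bsub>with_proj (path_graph n)\<^esub> v" by simp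
    moreover have "(v, Suc v) \<in> parcs (path_graph n)"
      using step by (auto simp: path_graph_def)
    ultimately show ?case by (rule reachable_adj_trans)
  qed
  then show "1 \<rightarrow>\<^sup>*\<^bsub>with_proj (path_graph n)\<^esub> v" if "v \<in> pverts (path_graph n)" for v
    using that by (simp add: path_graph_def)
qed

lemma connected_grid_graph:
  assumes "n \<ge> 1" "m \<ge> 1"
  shows "Digraph_Component.connected (with_proj (grid_graph n m))"
proof (rule connected_if_reachable_from[OF pair_graph_grid_graph])
  interpret pair_graph "grid_graph n m" by (rule pair_graph_grid_graph)
  show "(1, 1) \<in> pverts (grid_graph n m)" using assms by (simp add: grid_graph_def)
  have row: "1 \<le> i \<Longrightarrow> i \<le> n \<Longrightarrow> (1, 1) \<rightarrow>\<^sup>*\<^bsub>with_proj (grid_graph n m)\<^esub> (i, 1)" for i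
  proof (induction i rule: dec_induct)
    case base
    show ?case using assms by (intro reachable_refl) (simp add: grid_graph_def)
  next
    case (step i)
    then have "(1, 1) \<rightarrow>\<^sup>*\<^bsub>with_proj (grid_graph n m)\<^esub> (i, 1)" by simp
    moreover have "((i, 1), (Suc i, 1)) \<in> parcs (grid_graph n m)"
      using step assms by (auto simp: grid_graph_def)
    ultimately show ?case by (rule reachable_adj_trans)
  qed
  have "1 \<le> j \<Longrightarrow> j \<le> m \<Longrightarrow> (1, 1) \<rightarrow>\<^sup>*\<^bsub>with_proj (grid_graph n m)\<^esub> (i, j)"
    if i: "1 \<le> i" "i \<le> n" for i j
  proof (induction j rule: dec_induct)
    case base
    then show ?case using row[OF i] by simp
  next
    case (step j)
    then have "(1, 1) \<rightarrow>\<^sup>*\<^bsub>with_proj (grid_graph n m)\<^esub> (i, j)" by simp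
    moreover have "((i, j), (i, Suc j)) \<in> parcs (grid_graph n m)"
      using step i by (auto simp: grid_graph_def)
    ultimately show ?case by (rule reachable_adj_trans)
  qed
  then show "(1, 1) \<rightarrow>\<^sup>*\<^bsub>with_proj (grid_graph n m)\<^esub> v" if "v \<in> pverts (grid_graph n m)" for v
    using that by (cases v) (simp add: grid_graph_def)
qed

end

theory Submission
  imports Defs
begin

text \<open>
  In coordinates, an arithmetical structure is a positive primitive vector \<open>r\<close> such that at every
  vertex \<open>u\<close> the sum of \<open>r\<close> over the neighbours of \<open>u\<close> equals \<open>d u * r u\<close>
  (\<open>arithmetical_structure_iff\<close>). On the path, the neighbour sum at \<open>j\<close> is
  \<open>S j = x (j - 1) + x (j + 1)\<close>, with \<open>x\<close> extended by zero to \<open>0\<close> and \<open>m + 1\<close>. On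
  the grid, a vertex \<open>(i, j)\<close> has its neighbours in row \<open>i\<close>, which contribute \<open>S j\<close>
  when \<open>r (i, j) = x j\<close>, and its neighbours in column \<open>j\<close>, all of which
  carry the value \<open>x j\<close>. There are \<open>c i\<close> of the latter, where \<open>c i\<close> is the degree of \<open>i\<close> in the
  path on \<open>{1..n}\<close>. So the two defining equations are

  \<open>d' j * x j = S j\<close> on the path, and \<open>d (i, j) * x j = S j + c i * x j\<close> on the grid.

  They correspond under \<open>d (i, j) = d' j + c i\<close>, and each of them forces \<open>x j\<close> to divide \<open>S j\<close>.
  Primitivity is the same condition on both sides, as \<open>r\<close> and \<open>x\<close> take the same values, and \<open>d'\<close>
  is positive because \<open>S j > 0\<close> as soon as \<open>m \<ge> 2\<close>.
\<close>

lemma mult_vec_diag_minus_adjacency: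
  assumes "finite V" and "u \<in> V"
  shows "mult_vec V (\<lambda>u v. diag d u v - adjacency G u v) r u
           = d u * r u - (\<Sum>v\<in>V. adjacency G u v * r v)"
proof -
  have "(\<Sum>v\<in>V. diag d u v * r v) = (\<Sum>v\<in>V. if v = u then d u * r u else 0)"
    by (intro sum.cong) (auto simp: diag_def)
  also have "\<dots> = d u * r u"
    using assms by simp
  finally show ?thesis
    by (simp add: mult_vec_def left_diff_distrib sum_subtractf)
qed

lemma arithmetical_structure_iff:
  assumes "pair_graph G" and "Digraph_Component.connected (with_proj G)"
  shows "arithmetical_structure G d r \<longleftrightarrow>
     (\<forall>v\<in>pverts G. d v > 0 \<and> r v > 0) \<and> Gcd (r ` pverts G) = 1 \<and>
     (\<forall>u\<in>pverts G. d u * r u = (\<Sum>v\<in>pverts G. adjacency G u v * r v))"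
proof -
  interpret pair_graph G by fact
  show ?thesis
    using assms by (simp add: arithmetical_structure_def mult_vec_diag_minus_adjacency)
qed

lemma zero_ext_nonneg:
  assumes "\<And>j. j \<in> {1..m} \<Longrightarrow> x j \<ge> 0"
  shows "zero_ext m x j \<ge> 0"
  using assms by (simp add: zero_ext_def)

lemma path_neighbour_sum_pos:
  assumes "m \<ge> 2" and "j \<in> {1..m}" and pos: "\<And>k. k \<in> {1..m} \<Longrightarrow> x k > 0"
  shows "zero_ext m x (j - 1) + zero_ext m x (j + 1) > 0"
proof -
  have nonneg: "zero_ext m x k \<ge> 0" for k
    using pos by (intro zero_ext_nonneg) (simp add: less_imp_le)
  have "j - 1 \<in> {1..m} \<or> j + 1 \<in> {1..m}"
    using assms(1,2) by auto
  then have "zero_ext m x (j - 1) > 0 \<or> zero_ext m x (j + 1) > 0"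
    using pos unfolding zero_ext_def by presburger
  then show ?thesis
    using nonneg[of "j - 1"] nonneg[of "j + 1"] by linarith
qed

lemma path_adjacency_sum:
  assumes "j \<in> {1..m}"
  shows "(\<Sum>k\<in>{1..m}. adjacency (path_graph m) j k * x k)
           = zero_ext m x (j - 1) + zero_ext m x (j + 1)"
proof -
  have "(\<Sum>k\<in>{1..m}. adjacency (path_graph m) j k * x k)
      = (\<Sum>k\<in>{1..m}. (if k = j - 1 then x k else 0) + (if k = j + 1 then x k else 0))"
    using assms by (intro sum.cong) (auto simp: adjacency_def path_graph_def)
  also have "\<dots> = zero_ext m x (j - 1) + zero_ext m x (j + 1)"
    by (simp add: sum.distrib zero_ext_def)
  finally show ?thesis .
qed

text \<open>
  The degree is the neighbour sum of the all-one vector. Both ends of the path have degree \<open>1\<close>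
  only if they are distinct, whence \<open>n \<ge> 2\<close>: \<open>end_const 1 1\<close> is \<open>1\<close>, but the only vertex of the
  path on \<open>{1..1}\<close> has degree \<open>0\<close>.
\<close>

lemma path_degree:
  assumes "n \<ge> 2" and "i \<in> {1..n}"
  shows "(\<Sum>k\<in>{1..n}. adjacency (path_graph n) i k) = end_const n i"
  using path_adjacency_sum[OF assms(2), of "\<lambda>_. 1"] assms
  by (auto simp: zero_ext_def end_const_def)

text \<open>
  The grid is a Cartesian product: its adjacency matrix is \<open>I \<otimes> A + B \<otimes> I\<close> for the adjacency
  matrices \<open>A\<close> and \<open>B\<close> of the paths on \<open>{1..m}\<close> and \<open>{1..n}\<close>. The two summands
  are never both nonzero, because no two vertices are adjacent both within a row and within a
  column.
\<close>

lemma adjacency_grid_graph: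
  assumes "i \<in> {1..n}" "j \<in> {1..m}" "k \<in> {1..n}" "l \<in> {1..m}"
  shows "adjacency (grid_graph n m) (i, j) (k, l)
           = (if k = i then adjacency (path_graph m) j l else 0)
             + (if l = j then adjacency (path_graph n) i k else 0)"
  using assms by (auto simp: adjacency_def grid_graph_def path_graph_def)

lemma grid_adjacency_sum_column_constant:
  assumes "n \<ge> 2" and i: "i \<in> {1..n}" and j: "j \<in> {1..m}"
    and const: "\<And>k l. k \<in> {1..n} \<Longrightarrow> l \<in> {1..m} \<Longrightarrow> r (k, l) = x l"
  shows "(\<Sum>v\<in>{1..n} \<times> {1..m}. adjacency (grid_graph n m) (i, j) v * r v)
           = zero_ext m x (j - 1) + zero_ext m x (j + 1) + end_const n i * x j"
proof -
  let ?A = "\<lambda>l. adjacency (path_graph m) j l" and ?B = "\<lambda>k. adjacency (path_graph n) i k"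
  have "(\<Sum>v\<in>{1..n} \<times> {1..m}. adjacency (grid_graph n m) (i, j) v * r v)
      = (\<Sum>k\<in>{1..n}. \<Sum>l\<in>{1..m}. adjacency (grid_graph n m) (i, j) (k, l) * r (k, l))"
    by (simp add: sum.cartesian_product split_def)
  also have "\<dots> = (\<Sum>k\<in>{1..n}. \<Sum>l\<in>{1..m}.
      (if k = i then ?A l * x l else 0) + (if l = j then ?B k * x l else 0))"
    by (intro sum.cong refl)
       (use i j in \<open>auto simp: adjacency_grid_graph const distrib_right\<close>)
  also have "\<dots> = (\<Sum>k\<in>{1..n}. (if k = i then \<Sum>l\<in>{1..m}. ?A l * x l else 0) + ?B k * x j)"
    using j by (intro sum.cong refl) (auto simp: sum.distrib)
  also have "\<dots> = (\<Sum>l\<in>{1..m}. ?A l * x l) + (\<Sum>k\<in>{1..n}. ?B k) * x j"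
    using i by (simp add: sum.distrib sum_distrib_right)
  finally show ?thesis
    using path_adjacency_sum[OF j] path_degree[OF assms(1) i] by simp
qed

lemma arithmetical_structure_path_iff:
  assumes "m \<ge> 1"
  shows "arithmetical_structure (path_graph m) d x \<longleftrightarrow>
     (\<forall>j\<in>{1..m}. d j > 0 \<and> x j > 0) \<and> Gcd (x ` {1..m}) = 1 \<and>
     (\<forall>j\<in>{1..m}. d j * x j = zero_ext m x (j - 1) + zero_ext m x (j + 1))"
proof -
  have "pverts (path_graph m) = {1..m}"
    by (simp add: path_graph_def)
  then show ?thesis
    using assms
    by (simp only: arithmetical_structure_iff[OF pair_graph_path_graph connected_path_graph]
        path_adjacency_sum cong: ball_cong)
qed

lemma arithmetical_structure_grid_column_constant_iff:
  assumes "n \<ge> 2" and "m \<ge> 1"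
    and const: "\<And>i j. i \<in> {1..n} \<Longrightarrow> j \<in> {1..m} \<Longrightarrow> r (i, j) = x j"
  shows "arithmetical_structure (grid_graph n m) d r \<longleftrightarrow>
     (\<forall>i\<in>{1..n}. \<forall>j\<in>{1..m}. d (i, j) > 0 \<and> x j > 0) \<and> Gcd (x ` {1..m}) = 1 \<and>
     (\<forall>i\<in>{1..n}. \<forall>j\<in>{1..m}. d (i, j) * x j
        = zero_ext m x (j - 1) + zero_ext m x (j + 1) + end_const n i * x j)"
proof -
  have verts: "pverts (grid_graph n m) = {1..n} \<times> {1..m}"
    by (simp add: grid_graph_def)
  have "r ` ({1..n} \<times> {1..m}) = (x \<circ> snd) ` ({1..n} \<times> {1..m})"
    using const by (intro image_cong) auto
  also have "\<dots> = x ` {1..m}"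
    unfolding image_comp [symmetric] using assms(1) by simp
  finally have image: "r ` ({1..n} \<times> {1..m}) = x ` {1..m}" .
  have sum: "(\<Sum>v\<in>{1..n} \<times> {1..m}. adjacency (grid_graph n m) (i, j) v * r v)
      = zero_ext m x (j - 1) + zero_ext m x (j + 1) + end_const n i * x j"
    if "i \<in> {1..n}" "j \<in> {1..m}" for i j
    using grid_adjacency_sum_column_constant[of n i j m r x] assms(1) that const by blast
  have "1 \<le> n"
    using assms(1) by simp
  note iff = arithmetical_structure_iff[OF pair_graph_grid_graph
      connected_grid_graph[OF this assms(2)], unfolded verts]
  show ?thesis
    unfolding iff image by (simp only: split_paired_Ball_Sigma sum const cong: ball_cong)
qed

theorem theorem4p14:
  fixes n m :: nat
  assumes "n \<ge> 2" and "m \<ge> 2"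
  shows
    "(\<forall>(d :: nat \<times> nat \<Rightarrow> int) (r :: nat \<times> nat \<Rightarrow> int) (x :: nat \<Rightarrow> int).
        arithmetical_structure (grid_graph n m) d r \<and>
        (\<forall>i\<in>{1..n}. \<forall>j\<in>{1..m}. r (i, j) = x j) \<longrightarrow>
          (\<forall>j\<in>{1..m}. x j dvd zero_ext m x (j - 1) + zero_ext m x (j + 1)) \<and>
          (\<exists>!d'. d' \<in> extensional {1..m} \<and> arithmetical_structure (path_graph m) d' x))
     \<and>
     (\<forall>(d' :: nat \<Rightarrow> int) (x :: nat \<Rightarrow> int).
        arithmetical_structure (path_graph m) d' x \<longrightarrow>
          (\<exists>d :: nat \<times> nat \<Rightarrow> int.
             arithmetical_structure (grid_graph n m) d (\<lambda>(i, j). x j) \<and>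
             (\<forall>i\<in>{1..n}. \<forall>j\<in>{1..m}.
                rat_of_int (d (i, j)) =
                  rat_of_int (zero_ext m x (j - 1) + zero_ext m x (j + 1)) / rat_of_int (x j)
                  + rat_of_int (end_const n i))))"
proof (intro conjI allI impI)
  fix d r x
  assume "arithmetical_structure (grid_graph n m) d r \<and>
    (\<forall>i\<in>{1..n}. \<forall>j\<in>{1..m}. r (i, j) = x j)"
  then have grid: "arithmetical_structure (grid_graph n m) d r"
    and const: "\<And>i j. i \<in> {1..n} \<Longrightarrow> j \<in> {1..m} \<Longrightarrow> r (i, j) = x j"
    by auto
  let ?S = "\<lambda>j. zero_ext m x (j - 1) + zero_ext m x (j + 1)"
  have m: "m \<ge> 1" and one: "1 \<in> {1..n}"
    using assms by auto
  have grid': "(\<forall>i\<in>{1..n}. \<forall>j\<in>{1..m}. d (i, j) > 0 \<and> x j > 0) \<and> Gcd (x ` {1..m}) = 1 \<and>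
     (\<forall>i\<in>{1..n}. \<forall>j\<in>{1..m}. d (i, j) * x j = ?S j + end_const n i * x j)"
    using arithmetical_structure_grid_column_constant_iff[of n m r x d, THEN iffD1, OF assms(1) m]
      const grid by presburger
  have pos: "x j > 0" if "j \<in> {1..m}" for j
    using grid' one that by blast
  have dvd: "x j dvd ?S j" if "j \<in> {1..m}" for j
  proof -
    have "d (1, j) * x j = ?S j + end_const n 1 * x j"
      using grid' one that by blast
    then have "?S j = x j * (d (1, j) - end_const n 1)"
      by (simp add: algebra_simps)
    then show ?thesis ..
  qed
  then show "\<forall>j\<in>{1..m}. x j dvd ?S j" by blast

  \<comment> \<open>Restricted to the vertices, since only the values there are determined by \<open>x\<close>.\<close>
  define d' where "d' = restrict (\<lambda>j. ?S j div x j) {1..m}"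
  show "\<exists>!d'. d' \<in> extensional {1..m} \<and> arithmetical_structure (path_graph m) d' x"
  proof (rule ex1I[of _ d'], intro conjI)
    show "d' \<in> extensional {1..m}"
      by (simp add: d'_def)
    have "d' j * x j = ?S j \<and> d' j > 0" if j: "j \<in> {1..m}" for j
    proof -
      have eq: "d' j * x j = ?S j"
        using dvd[OF j] j by (simp add: d'_def)
      moreover have "?S j > 0"
        using path_neighbour_sum_pos[OF assms(2) j, of x] pos by blast
      ultimately have "d' j > 0"
        using pos[OF j] by (metis zero_less_mult_pos2)
      with eq show ?thesis by blast
    qed
    then show "arithmetical_structure (path_graph m) d' x"
      unfolding arithmetical_structure_path_iff[OF m] using pos grid' by blast
  next
    fix e
    assume e: "e \<in> extensional {1..m} \<and> arithmetical_structure (path_graph m) e x"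
    show "e = d'"
    proof (rule extensionalityI[of _ "{1..m}"])
      fix j assume j: "j \<in> {1..m}"
      have "e j * x j = ?S j"
        using e j unfolding arithmetical_structure_path_iff[OF m] by blast
      then have "?S j div x j = e j"
        using pos[OF j] by (metis less_irrefl nonzero_mult_div_cancel_right)
      then show "e j = d' j"
        using j by (simp add: d'_def)
    qed (use e in \<open>auto simp: d'_def\<close>)
  qed
next
  fix d' x
  assume path: "arithmetical_structure (path_graph m) d' x"
  let ?S = "\<lambda>j. zero_ext m x (j - 1) + zero_ext m x (j + 1)"
  let ?d = "\<lambda>(i, j). d' j + end_const n i"
  have m: "m \<ge> 1"
    using assms(2) by simp
  note path' = path[unfolded arithmetical_structure_path_iff[OF m]]
  have c: "end_const n i > 0" for i
    by (simp add: end_const_def)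
  have "?d (i, j) > 0 \<and> x j > 0 \<and> ?d (i, j) * x j = ?S j + end_const n i * x j"
    if "j \<in> {1..m}" for i j
    using path' c[of i] that by (auto simp: distrib_right intro: add_pos_pos)
  then have "arithmetical_structure (grid_graph n m) ?d (\<lambda>(i, j). x j)"
    using path' assms(1) m
    by (subst arithmetical_structure_grid_column_constant_iff[where x = x]) auto
  moreover have "rat_of_int (?d (i, j))
      = rat_of_int (?S j) / rat_of_int (x j) + rat_of_int (end_const n i)"
    if j: "j \<in> {1..m}" for i j
  proof -
    have "x j \<noteq> 0" and "?S j = d' j * x j"
      using path' j by force+
    then show ?thesis by simp
  qed
  ultimately show "\<exists>d. arithmetical_structure (grid_graph n m) d (\<lambda>(i, j). x j) \<and>
      (\<forall>i\<in>{1..n}. \<forall>j\<in>{1..m}. rat_of_int (d (i, j))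
         = rat_of_int (?S j) / rat_of_int (x j) + rat_of_int (end_const n i))"
    by blast
qed

end
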